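(* Let $G$ be an outerplanar near triangulation with outer cycle $C$, let $u,v\in V(C)$ with $uv\in E(C)$, let $\mathcal{H}=(L,H)$ be a $2$-fold correspondence cover of $G$, and let $\phi$ be a partial $3$-defective $\mathcal{H}$-coloring of $G$ with domain $\{u,v\}$. Then $\phi$ can be extended to a $3$-defective $\mathcal{H}$-coloring $\psi$ of $G$ such that: (1) if $\phi(u)$ and $\phi(v)$ are adjacent in $H$, then $\mathrm{def}_\psi(u)\le 1$ and $\mathrm{def}_\psi(v)\le 2$; (2) if $\phi(u)$ and $\phi(v)$ are not adjacent in $H$, then $\mathrm{def}_\psi(u)=0$ and $\mathrm{def}_\psi(v)\le 1$.
   Context: All graphs are finite, simple and undirected. An outerplanar near triangulation is an outerplanar graph embedded with all vertices on the outer face, bounded by the outer cycle $C$, in which every interior face is a triangle. A correspondence cover of $G$ is a pair $\mathcal{H}=(L,H)$ where $H$ is a graph and $L:V(G)\to 2^{V(H)}$ satisfies: (1) $\{L(v)\}$ partitions $V(H)$; (2) each $L(v)$ is independent in $H$; (3) for all $u,v$, the edges of $H[L(u)\cup L(v)]$ form a matching, empty if $uv\notin E(G)$. It is $2$-fold if $|L(v)|\ge 2$ for all $v$. A (partial) $\mathcal{H}$-coloring is a (partial) map $\phi$ with $\phi(w)\in L(w)$ wherever defined. For an $\mathcal{H}$-coloring $\psi$, $\mathrm{def}_\psi(w)$ is the number of neighbors $w'$ of $w$ in $G$ with $\psi(w')$ adjacent to $\psi(w)$ in $H$; $\psi$ is $3$-defective if $\mathrm{def}_\psi(w)\le 3$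 for all $w$ (for a partial coloring, counting only colored neighbors). *)

theory Defs
  imports "HOL-Analysis.Analysis"
begin

section \<open>Finite simple graphs\<close>

definition simple_graph :: "'a set \<Rightarrow> 'a set set \<Rightarrow> bool" where
  "simple_graph V E \<longleftrightarrow> finite V \<and> (\<forall>e\<in>E. e \<subseteq> V \<and> card e = 2)"

definition induced_edges :: "'a set set \<Rightarrow> 'a set \<Rightarrow> 'a set set" where
  "induced_edges E W = {e \<in> E. e \<subseteq> W}"

definition independent_set :: "'a set set \<Rightarrow> 'a set \<Rightarrow> bool" where
  "independent_set E W \<longleftrightarrow> induced_edges E W = {}"

definition matching :: "'a set set \<Rightarrow> bool" where
  "matching M \<longleftrightarrow> pairwise disjnt M"

definition cycle_edges :: "'a list \<Rightarrow> 'a set set" where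
  "cycle_edges c = {{c ! i, c ! (Suc i mod length c)} | i. i < length c}"

definition is_cycle :: "'a set \<Rightarrow> 'a set set \<Rightarrow> 'a list \<Rightarrow> bool" where
  "is_cycle V E c \<longleftrightarrow>
     3 \<le> length c \<and> distinct c \<and> set c \<subseteq> V \<and> cycle_edges c \<subseteq> E"

section \<open>Drawings in the plane\<close>

text \<open>The plane is the type of complex numbers. A drawing places the vertex \<open>x\<close> at the point
  \<open>p x\<close> and draws the edge \<open>e\<close> as the simple arc \<open>\<gamma> e\<close>. Since \<open>p\<close> is injective on \<open>V\<close>,
  the last clause says that two distinct edges meet exactly in their common endpoints.\<close>

definition plane_drawing ::
  "'a set \<Rightarrow> 'a set set \<Rightarrow> ('a \<Rightarrow> complex) \<Rightarrow> ('a set \<Rightarrow> real \<Rightarrow> complex) \<Rightarrow> bool" where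
  "plane_drawing V E p \<gamma> \<longleftrightarrow>
     inj_on p V \<and>
     (\<forall>e\<in>E. arc (\<gamma> e) \<and> {pathstart (\<gamma> e), pathfinish (\<gamma> e)} = p ` e) \<and>
     (\<forall>e\<in>E. path_image (\<gamma> e) \<inter> p ` V = p ` e) \<and>
     (\<forall>e\<in>E. \<forall>f\<in>E. e \<noteq> f \<longrightarrow> path_image (\<gamma> e) \<inter> path_image (\<gamma> f) = p ` (e \<inter> f))"

definition edge_points :: "('a set \<Rightarrow> real \<Rightarrow> complex) \<Rightarrow> 'a set set \<Rightarrow> complex set" where
  "edge_points \<gamma> F = (\<Union>e\<in>F. path_image (\<gamma> e))"

definition drawing_points ::
  "'a set \<Rightarrow> 'a set set \<Rightarrow> ('a \<Rightarrow> complex) \<Rightarrow> ('a set \<Rightarrow> real \<Rightarrow> complex) \<Rightarrow> complex set" where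
  "drawing_points V E p \<gamma> = p ` V \<union> edge_points \<gamma> E"

definition faces ::
  "'a set \<Rightarrow> 'a set set \<Rightarrow> ('a \<Rightarrow> complex) \<Rightarrow> ('a set \<Rightarrow> real \<Rightarrow> complex) \<Rightarrow> complex set set" where
  "faces V E p \<gamma> = components (- drawing_points V E p \<gamma>)"

definition interior_faces ::
  "'a set \<Rightarrow> 'a set set \<Rightarrow> ('a \<Rightarrow> complex) \<Rightarrow> ('a set \<Rightarrow> real \<Rightarrow> complex) \<Rightarrow> complex set set" where
  "interior_faces V E p \<gamma> = {F \<in> faces V E p \<gamma>. bounded F}"

text \<open>The library's \<open>outside S\<close> is the union of the unbounded components of the complement
  of \<open>S\<close>. A drawing of a finite graph is compact, so there is exactly one such component.\<close>

definition outer_face ::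
  "'a set \<Rightarrow> 'a set set \<Rightarrow> ('a \<Rightarrow> complex) \<Rightarrow> ('a set \<Rightarrow> real \<Rightarrow> complex) \<Rightarrow> complex set" where
  "outer_face V E p \<gamma> = outside (drawing_points V E p \<gamma>)"

definition triangle :: "'a set set \<Rightarrow> 'a set set \<Rightarrow> bool" where
  "triangle E T \<longleftrightarrow>
     (\<exists>x y z. x \<noteq> y \<and> y \<noteq> z \<and> x \<noteq> z \<and> T = {{x, y}, {y, z}, {x, z}} \<and> T \<subseteq> E)"

text \<open>A graph \<open>(V, E)\<close> together with its drawing \<open>(p, \<gamma>)\<close> and its outer cycle \<open>c\<close>.\<close>

definition outerplanar_near_triangulation ::
  "'a set \<Rightarrow> 'a set set \<Rightarrow> ('a \<Rightarrow> complex) \<Rightarrow> ('a set \<Rightarrow> real \<Rightarrow> complex) \<Rightarrow> 'a list \<Rightarrow> bool" where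
  "outerplanar_near_triangulation V E p \<gamma> c \<longleftrightarrow>
     simple_graph V E \<and>
     plane_drawing V E p \<gamma> \<and>
     is_cycle V E c \<and>
     p ` V \<subseteq> frontier (outer_face V E p \<gamma>) \<and>
     frontier (outer_face V E p \<gamma>) = edge_points \<gamma> (cycle_edges c) \<and>
     (\<forall>F\<in>interior_faces V E p \<gamma>. \<exists>T. triangle E T \<and> frontier F = edge_points \<gamma> T)"

section \<open>Correspondence covers and defective colorings\<close>

definition correspondence_cover ::
  "'a set \<Rightarrow> 'a set set \<Rightarrow> ('a \<Rightarrow> 'b set) \<Rightarrow> 'b set \<Rightarrow> 'b set set \<Rightarrow> bool" where
  "correspondence_cover V E L VH EH \<longleftrightarrow>
     simple_graph VH EH \<and>
     disjoint_family_on L V \<and> (\<Union>x\<in>V. L x) = VH \<and>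
     (\<forall>x\<in>V. independent_set EH (L x)) \<and>
     (\<forall>x\<in>V. \<forall>y\<in>V. matching (induced_edges EH (L x \<union> L y)) \<and>
        ({x, y} \<notin> E \<longrightarrow> induced_edges EH (L x \<union> L y) = {}))"

definition k_fold :: "nat \<Rightarrow> 'a set \<Rightarrow> ('a \<Rightarrow> 'b set) \<Rightarrow> bool" where
  "k_fold k V L \<longleftrightarrow> (\<forall>x\<in>V. k \<le> card (L x))"

definition partial_coloring :: "'a set \<Rightarrow> ('a \<Rightarrow> 'b set) \<Rightarrow> ('a \<Rightarrow> 'b option) \<Rightarrow> bool" where
  "partial_coloring V L \<phi> \<longleftrightarrow> dom \<phi> \<subseteq> V \<and> (\<forall>x\<in>dom \<phi>. the (\<phi> x) \<in> L x)"

definition coloring :: "'a set \<Rightarrow> ('a \<Rightarrow> 'b set) \<Rightarrow> ('a \<Rightarrow> 'b option) \<Rightarrow> bool" where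
  "coloring V L \<psi> \<longleftrightarrow> partial_coloring V L \<psi> \<and> dom \<psi> = V"

definition defect :: "'a set set \<Rightarrow> 'b set set \<Rightarrow> ('a \<Rightarrow> 'b option) \<Rightarrow> 'a \<Rightarrow> nat" where
  "defect E EH \<phi> x = card {y \<in> dom \<phi>. {x, y} \<in> E \<and> {the (\<phi> x), the (\<phi> y)} \<in> EH}"

definition defective :: "nat \<Rightarrow> 'a set set \<Rightarrow> 'b set set \<Rightarrow> ('a \<Rightarrow> 'b option) \<Rightarrow> bool" where
  "defective d E EH \<phi> \<longleftrightarrow> (\<forall>x\<in>dom \<phi>. defect E EH \<phi> x \<le> d)"

end

theory Submission
  imports Defs
begin

text \<open>
  The outer face lies outside the Jordan curve drawn by the
  outer cycle and has that curve as its frontier, so it is the whole outside; hence every chord is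
  drawn inside the curve and, by the theta-curve theorem, separates the two arcs between its ends,
  so chords do not cross.
  Cut the outer cycle at the edge \<open>uv\<close>. Let \<open>w\<close> be the last neighbour of the first vertex before
  the last vertex; no edge other than one between the two end vertices passes over \<open>w\<close>. Give \<open>w\<close> a
  colour without conflict with \<open>u\<close> and recurse on both sides of \<open>w\<close>, demanding that \<open>u\<close> and \<open>v\<close>
  gain no conflict and allowing \<open>w\<close> to gain one on each side. Then \<open>w\<close> has at most three conflicts,
  \<open>v\<close> gains at most the one with \<open>w\<close>, and \<open>u\<close> gains none.
\<close>

section \<open>Colouring along a path with non-crossing chords\<close>

text \<open>The cut vertex \<open>k\<close> is the last neighbour of \<open>i\<close> before
  \<open>j\<close>. An edge over \<open>k\<close> starting after \<open>i\<close> would cross the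
  edge from \<open>i\<close> to \<open>k\<close>; one starting at \<open>i\<close> and ending before
  \<open>j\<close> would contradict maximality.\<close>

lemma noncrossing_cut_vertex:
  fixes E :: "nat \<Rightarrow> nat \<Rightarrow> bool"
  assumes "Suc i < j"
    and noncrossing: "\<And>a b c d. i \<le> a \<Longrightarrow> a < b \<Longrightarrow> b < c \<Longrightarrow> c < d \<Longrightarrow> d \<le> j \<Longrightarrow> E a c \<Longrightarrow> \<not> E b d"
  obtains k where "i < k" "k < j"
    and "\<And>a b. i \<le> a \<Longrightarrow> a < k \<Longrightarrow> k < b \<Longrightarrow> b \<le> j \<Longrightarrow> E a b \<Longrightarrow> a = i \<and> b = j"
proof -
  \<comment> \<open>\<open>Suc i\<close> is the default when \<open>i\<close> has no neighbour
    strictly between \<open>i\<close> and \<open>j\<close>. No vertex lies strictly between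
    \<open>i\<close> and \<open>Suc i\<close>, so the crossing argument then has nothing to
    exclude.\<close>
  let ?K = "insert (Suc i) {k. i < k \<and> k < j \<and> E i k}"
  define k where "k = Max ?K"
  have fin: "finite ?K" by simp
  have kK: "k \<in> ?K" unfolding k_def using fin by (rule Max_in) simp
  have kmax: "\<And>x. x \<in> ?K \<Longrightarrow> x \<le> k" unfolding k_def using fin by (rule Max_ge)
  show thesis
  proof
    show "i < k" "k < j" using kK assms(1) by auto
    fix a b assume ab: "i \<le> a" "a < k" "k < b" "b \<le> j" "E a b"
    have "a = i"
    proof (rule ccontr)
      assume "a \<noteq> i"
      then have "i < a" "k \<noteq> Suc i" using ab by auto
      then have "E i k" using kK by auto
      then show False using noncrossing[of i a k b] ab \<open>i < a\<close> by auto
    qed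
    moreover have "b = j"
    proof (rule ccontr)
      assume "b \<noteq> j"
      then have "b \<in> ?K" using ab \<open>a = i\<close> by auto
      then show False using kmax ab by fastforce
    qed
    ultimately show "a = i \<and> b = j" ..
  qed
qed

text \<open>Vertices are positions on a path, and \<open>K x a y b\<close> stands for a conflict
  between colour \<open>a\<close> at \<open>x\<close> and colour \<open>b\<close> at
  \<open>y\<close>. The end \<open>t\<close> is protected. Ends are counted only against inner
  vertices, because a conflict between the two ends is prescribed by \<open>\<phi>\<close>; this
  makes the bounds strong enough for induction on the length.\<close>

lemma defective_extension_on_interval:
  fixes i j t :: nat and L :: "nat \<Rightarrow> 'b set" and E :: "nat \<Rightarrow> nat \<Rightarrow> bool"
    and K :: "nat \<Rightarrow> 'b \<Rightarrow> nat \<Rightarrow> 'b \<Rightarrow> bool"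
  assumes "i < j" and "t \<in> {i, j}"
    and noncrossing: "\<And>a b c d. i \<le> a \<Longrightarrow> a < b \<Longrightarrow> b < c \<Longrightarrow> c < d \<Longrightarrow> d \<le> j \<Longrightarrow> E a c \<Longrightarrow> \<not> E b d"
    and conflict_edge: "\<And>x a y b. K x a y b \<Longrightarrow> x \<noteq> y \<and> E x y"
    and conflict_sym: "\<And>x a y b. K x a y b \<Longrightarrow> K y b x a"
    and avoid: "\<And>x y b. i \<le> x \<Longrightarrow> x \<le> j \<Longrightarrow> i \<le> y \<Longrightarrow> y \<le> j \<Longrightarrow> x \<noteq> y \<Longrightarrow> b \<in> L y \<Longrightarrow> \<exists>a\<in>L x. \<not> K x a y b"
    and "\<phi> i \<in> L i" and "\<phi> j \<in> L j"
  shows "\<exists>\<psi>. \<psi> i = \<phi> i \<and> \<psi> j = \<phi> j \<and> (\<forall>x\<in>{i..j}. \<psi> x \<in> L x) \<and>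
    (\<forall>x\<in>{i<..<j}. card {y\<in>{i..j}. K x (\<psi> x) y (\<psi> y)} \<le> 3) \<and>
    (\<forall>x\<in>{i, j}. card {y\<in>{i<..<j}. K x (\<psi> x) y (\<psi> y)} \<le> (if x = t then 0 else 1))"
  using assms(1,2) noncrossing avoid assms(7,8)
proof (induction "j - i" arbitrary: i j t \<phi> rule: less_induct)
  case less
  show ?case
  proof (cases "Suc i < j")
    case False
    then have "j = Suc i" using less.prems(1) by simp
    moreover have "{i<..<j} = {}" using \<open>j = Suc i\<close> by auto
    moreover have "{i..j} = {i, j}" using \<open>j = Suc i\<close> by auto
    ultimately show ?thesis using less.prems by (intro exI[of _ \<phi>]) auto
  next
    case True
    obtain k where k: "i < k" "k < j"
      and over: "\<And>a b. i \<le> a \<Longrightarrow> a < k \<Longrightarrow> k < b \<Longrightarrow> b \<le> j \<Longrightarrow> E a b \<Longrightarrow> a = i \<and> b = j"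
      using noncrossing_cut_vertex[of i j E] True less.prems(3) by metis
    have t: "t = i \<or> t = j" using less.prems by auto
    \<comment> \<open>The hypothesis \<open>avoid\<close> excludes a conflict with one given
      neighbour only, so the colour of \<open>k\<close> is chosen against \<open>t\<close>; the
      other end may gain its single conflict here.\<close>
    have "\<exists>d\<in>L k. \<not> K k d t (\<phi> t)"
      using less.prems(4)[of k t "\<phi> t"] t k less.prems by fastforce
    then obtain d where d: "d \<in> L k" "\<not> K k d t (\<phi> t)" by blast
    let ?\<phi> = "\<phi>(k := d)"
    \<comment> \<open>On the left the protected end is \<open>i\<close>, and on the right it will be
      \<open>j\<close>, whatever \<open>t\<close> is. The allowance of one conflict falls on
      \<open>k\<close> both times.\<close>
    have "\<exists>\<psi>. \<psi> i = ?\<phi> i \<and> \<psi> k = ?\<phi> k \<and> (\<forall>x\<in>{i..k}. \<psi> x \<in> L x) \<and>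
      (\<forall>x\<in>{i<..<k}. card {y\<in>{i..k}. K x (\<psi> x) y (\<psi> y)} \<le> 3) \<and>
      (\<forall>x\<in>{i, k}. card {y\<in>{i<..<k}. K x (\<psi> x) y (\<psi> y)} \<le> (if x = i then 0 else 1))"
    proof (rule less.hyps)
      show "\<not> E b e" if "i \<le> a" "a < b" "b < c" "c < e" "e \<le> k" "E a c" for a b c e
        using less.prems(3)[of a b c e] that k by simp
      show "\<exists>a\<in>L x. \<not> K x a y b"
        if "i \<le> x" "x \<le> k" "i \<le> y" "y \<le> k" "x \<noteq> y" "b \<in> L y" for x y b
        using less.prems(4)[of x y b] that k by simp
    qed (use k d less.prems(5,6) in auto)
    then obtain \<psi>1 where \<psi>1: "\<psi>1 i = \<phi> i" "\<psi>1 k = d" "\<And>x. x \<in> {i..k} \<Longrightarrow> \<psi>1 x \<in> L x"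
      "\<And>x. x \<in> {i<..<k} \<Longrightarrow> card {y\<in>{i..k}. K x (\<psi>1 x) y (\<psi>1 y)} \<le> 3"
      "card {y\<in>{i<..<k}. K i (\<psi>1 i) y (\<psi>1 y)} = 0"
      "card {y\<in>{i<..<k}. K k (\<psi>1 k) y (\<psi>1 y)} \<le> 1" using k by auto
    have "\<exists>\<psi>. \<psi> k = ?\<phi> k \<and> \<psi> j = ?\<phi> j \<and> (\<forall>x\<in>{k..j}. \<psi> x \<in> L x) \<and>
      (\<forall>x\<in>{k<..<j}. card {y\<in>{k..j}. K x (\<psi> x) y (\<psi> y)} \<le> 3) \<and>
      (\<forall>x\<in>{k, j}. card {y\<in>{k<..<j}. K x (\<psi> x) y (\<psi> y)} \<le> (if x = j then 0 else 1))"
    proof (rule less.hyps)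
      show "\<not> E b e" if "k \<le> a" "a < b" "b < c" "c < e" "e \<le> j" "E a c" for a b c e
        using less.prems(3)[of a b c e] that k by simp
      show "\<exists>a\<in>L x. \<not> K x a y b"
        if "k \<le> x" "x \<le> j" "k \<le> y" "y \<le> j" "x \<noteq> y" "b \<in> L y" for x y b
        using less.prems(4)[of x y b] that k by simp
    qed (use k d less.prems(5,6) in auto)
    then obtain \<psi>2 where \<psi>2: "\<psi>2 k = d" "\<psi>2 j = \<phi> j" "\<And>x. x \<in> {k..j} \<Longrightarrow> \<psi>2 x \<in> L x"
      "\<And>x. x \<in> {k<..<j} \<Longrightarrow> card {y\<in>{k..j}. K x (\<psi>2 x) y (\<psi>2 y)} \<le> 3"
      "card {y\<in>{k<..<j}. K j (\<psi>2 j) y (\<psi>2 y)} = 0"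
      "card {y\<in>{k<..<j}. K k (\<psi>2 k) y (\<psi>2 y)} \<le> 1" using k by auto
    \<comment> \<open>Both halves give \<open>k\<close> the colour \<open>d\<close>, so the glued
      map agrees with each half up to and including \<open>k\<close>.\<close>
    define \<psi> where "\<psi> x = (if x \<le> k then \<psi>1 x else \<psi>2 x)" for x
    have left: "\<psi> x = \<psi>1 x" if "x \<le> k" for x using that by (simp add: \<psi>_def)
    have right: "\<psi> x = \<psi>2 x" if "k \<le> x" for x using that \<psi>1(2) \<psi>2(1) by (simp add: \<psi>_def)
    have sep: "a = i \<and> b = j"
      if "K a x b y \<or> K b y a x" "i \<le> a" "a < k" "k < b" "b \<le> j" for a b x y
      using over that conflict_edge conflict_sym by metis
    have no_i: "\<not> K i (\<psi> i) y (\<psi> y)" if "y \<in> {i<..<k}" for y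
      using \<psi>1(5) that left[of i] left[of y] k by auto
    have no_j: "\<not> K j (\<psi> j) y (\<psi> y)" if "y \<in> {k<..<j}" for y
      using \<psi>2(5) that right[of j] right[of y] k by auto
    have t_k: "\<not> K t (\<psi> t) k (\<psi> k)"
      using t d conflict_sym \<psi>1(1) \<psi>2(2) \<psi>1(2) k left[of i] left[of k] right[of j] by auto
    \<comment> \<open>By \<open>sep\<close>, an end has no conflict with inner vertices beyond
      \<open>k\<close>, and by the recursive bounds none on its own side. Only \<open>k\<close>
      remains, and \<open>t\<close> does not conflict with \<open>k\<close>.\<close>
    have ends: "card {y\<in>{i<..<j}. K x (\<psi> x) y (\<psi> y)} \<le> (if x = t then 0 else 1)"
      if x: "x \<in> {i, j}" for x
    proof -
      have "y = k" if y: "y \<in> {i<..<j}" "K x (\<psi> x) y (\<psi> y)" for y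
      proof (rule ccontr)
        assume "y \<noteq> k"
        then consider "y \<in> {i<..<k}" | "y \<in> {k<..<j}" using y by fastforce
        then show False
        proof cases
          case 1
          then show ?thesis using x y no_i sep[of y "\<psi> y" j "\<psi> j"] k by auto
        next
          case 2
          then show ?thesis using x y no_j sep[of i "\<psi> i" y "\<psi> y"] k by auto
        qed
      qed
      then have "{y\<in>{i<..<j}. K x (\<psi> x) y (\<psi> y)} \<subseteq> (if x = t then {} else {k})"
        using t_k by auto
      from card_mono[OF _ this] show ?thesis by (auto split: if_splits)
    qed
    have mid: "card {y\<in>{i..j}. K x (\<psi> x) y (\<psi> y)} \<le> 3" if x: "x \<in> {i<..<j}" for x
    proof -
      consider "x \<in> {i<..<k}" | "x = k" | "x \<in> {k<..<j}" using x by fastforce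
      then show ?thesis
      proof cases
        \<comment> \<open>An inner vertex of one half has no conflict across \<open>k\<close>, so
          its count is the one from the recursive call.\<close>
        case 1
        then have "{y\<in>{i..j}. K x (\<psi> x) y (\<psi> y)} = {y\<in>{i..k}. K x (\<psi>1 x) y (\<psi>1 y)}"
          using sep[of x "\<psi> x"] k left by fastforce
        then show ?thesis using \<psi>1(4)[OF 1] by simp
      next
        case 3
        then have "{y\<in>{i..j}. K x (\<psi> x) y (\<psi> y)} = {y\<in>{k..j}. K x (\<psi>2 x) y (\<psi>2 y)}"
          using sep[of _ _ x "\<psi> x"] k right by fastforce
        then show ?thesis using \<psi>2(4)[OF 3] by simp
      next
        case 2
        let ?A = "{y\<in>{i<..<k}. K k (\<psi>1 k) y (\<psi>1 y)}"
        let ?B = "{y\<in>{k<..<j}. K k (\<psi>2 k) y (\<psi>2 y)}"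
        \<comment> \<open>\<open>?s\<close> is the unprotected end. The conflicts of
          \<open>k\<close> are at most one inside each half and possibly \<open>?s\<close>, which
          makes three.\<close>
        let ?s = "if t = i then j else i"
        have "y \<in> ?A \<union> ?B \<union> {?s}" if y: "y \<in> {i..j}" "K k (\<psi> k) y (\<psi> y)" for y
        proof -
          have "y \<noteq> t" using t_k y conflict_sym by blast
          moreover have "y \<noteq> k" using y conflict_edge by blast
          ultimately consider "y = ?s" | "y \<in> {i<..<k}" | "y \<in> {k<..<j}"
            using y t by (cases y k rule: linorder_cases) (auto split: if_splits simp: le_less)
          then show ?thesis
            by cases (use y left[of k] left[of y] right[of k] right[of y] in auto)
        qed
        then have "{y\<in>{i..j}. K x (\<psi> x) y (\<psi> y)} \<subseteq> ?A \<union> ?B \<union> {?s}" using 2 by blast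
        then have "card {y\<in>{i..j}. K x (\<psi> x) y (\<psi> y)} \<le> card (?A \<union> ?B \<union> {?s})"
          by (intro card_mono) auto
        also have "\<dots> \<le> card ?A + card ?B + 1"
          using card_Un_le[of "?A \<union> ?B" "{?s}"] card_Un_le[of ?A ?B] by simp
        also have "\<dots> \<le> 3" using \<psi>1(6) \<psi>2(6) by linarith
        finally show ?thesis .
      qed
    qed
    have "\<psi> i = \<phi> i" "\<psi> j = \<phi> j" using left[of i] right[of j] k \<psi>1(1) \<psi>2(2) by auto
    moreover have "\<forall>x\<in>{i..j}. \<psi> x \<in> L x" using \<psi>1(3) \<psi>2(3) by (auto simp: \<psi>_def)
    ultimately show ?thesis using mid ends by blast
  qed
qed

section \<open>Edge sets of walks and cycles\<close>

text \<open>List recursion replaces the modular indices of \<open>cycle_edges\<close>, so that a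
  cycle can be split at vertices into walks.\<close>

fun walk_edges :: "'a list \<Rightarrow> 'a set set" where
  "walk_edges (x # y # zs) = insert {x, y} (walk_edges (y # zs))"
| "walk_edges _ = {}"

lemma walk_edges_append:
  "walk_edges (xs @ y # zs) = walk_edges (xs @ [y]) \<union> walk_edges (y # zs)"
proof (induction xs)
  case (Cons x xs)
  then show ?case by (cases xs) auto
qed simp

lemma walk_edges_subset: "e \<in> walk_edges ws \<Longrightarrow> e \<subseteq> set ws"
  by (induction ws rule: walk_edges.induct) auto

lemma Union_walk_edges:
  assumes "2 \<le> length ws"
  shows "\<Union> (walk_edges ws) = set ws"
  using assms
proof (induction ws rule: walk_edges.induct)
  case (1 x y zs)
  then show ?case by (cases zs) auto
qed auto

text \<open>Makes a chord different from every edge of the boundary walk joining its ends: the first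
  edge leads to an inner vertex, and all later edges miss \<open>x\<close>.\<close>

lemma ends_notin_walk_edges:
  assumes "distinct (x # B @ [y])" and "B \<noteq> []"
  shows "{x, y} \<notin> walk_edges (x # B @ [y])"
proof -
  obtain b B' where B: "B = b # B'" using assms(2) by (cases B) auto
  have "{x, y} \<noteq> {x, b}" using assms(1) B by (auto simp: doubleton_eq_iff)
  moreover have "{x, y} \<notin> walk_edges (b # B' @ [y])"
    using walk_edges_subset[of "{x, y}" "b # B' @ [y]"] assms(1) B by auto
  ultimately show ?thesis using B by simp
qed

lemma walk_edges_nth: "walk_edges ws = {{ws ! i, ws ! Suc i} | i. Suc i < length ws}"
proof (induction ws rule: walk_edges.induct)
  case (1 x y zs)
  have "{{(x # y # zs) ! i, (x # y # zs) ! Suc i} | i. Suc i < length (x # y # zs)} =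
    insert {x, y} {{(y # zs) ! i, (y # zs) ! Suc i} | i. Suc i < length (y # zs)}" (is "?A = ?B")
  proof (intro equalityI subsetI)
    fix e assume "e \<in> ?A"
    then obtain i where "e = {(x # y # zs) ! i, (x # y # zs) ! Suc i}" "Suc i < length (x # y # zs)"
      by blast
    then show "e \<in> ?B" by (cases i) auto
  next
    fix e assume "e \<in> ?B"
    then consider "e = {x, y}"
      | i where "e = {(y # zs) ! i, (y # zs) ! Suc i}" "Suc i < length (y # zs)" by blast
    then show "e \<in> ?A"
    proof cases
      case 1
      then show ?thesis by (auto intro!: exI[of _ 0])
    next
      case 2
      then show ?thesis by (auto intro!: exI[of _ "Suc i"])
    qed
  qed
  then show ?case using 1 by simp
qed auto

lemma cycle_edges_eq_walk_edges:
  assumes "c \<noteq> []"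
  shows "cycle_edges c = walk_edges (c @ [hd c])"
proof -
  have "{c ! i, c ! (Suc i mod length c)} = {(c @ [hd c]) ! i, (c @ [hd c]) ! Suc i}"
    if "i < length c" for i
    using that assms by (cases "Suc i = length c") (simp_all add: nth_append hd_conv_nth)
  then have "{{c ! i, c ! (Suc i mod length c)} | i. i < length c} =
      {{(c @ [hd c]) ! i, (c @ [hd c]) ! Suc i} | i. i < length c}"
    by (intro Collect_cong) metis
  then show ?thesis unfolding cycle_edges_def walk_edges_nth by simp
qed

text \<open>Rotation invariance. Both closed walks consist of a walk from the head of
  \<open>xs\<close> to the head of \<open>ys\<close> and a walk back.\<close>

lemma cycle_edges_append_commute: "cycle_edges (xs @ ys) = cycle_edges (ys @ xs)"
proof (cases "xs = [] \<or> ys = []")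
  case False
  then obtain x xs' y ys' where "xs = x # xs'" "ys = y # ys'" by (meson neq_Nil_conv)
  then show ?thesis
    using walk_edges_append[of xs y "ys' @ [x]"] walk_edges_append[of ys x "xs' @ [y]"]
    by (auto simp: cycle_edges_eq_walk_edges)
qed auto

section \<open>Chords of the outer cycle do not cross\<close>

text \<open>The arc \<open>c3\<close> divides the inside of the closed curve formed by
  \<open>c1\<close> and \<open>c2\<close> into two regions. The open arc of \<open>c4\<close> is
  connected and misses \<open>c3\<close>, so it stays in one region; but \<open>s\<close> is not in
  the closure of the region along \<open>c2\<close>, nor \<open>t\<close> in that of the region
  along \<open>c1\<close>.\<close>

lemma theta_curve_no_crossing:
  fixes c1 c2 c3 c4 :: "real \<Rightarrow> complex"
  assumes arcs: "arc c1" "arc c2" "arc c3" "arc c4"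
    and start: "pathstart c1 = a" "pathstart c2 = a" "pathstart c3 = a"
    and finish: "pathfinish c1 = b" "pathfinish c2 = b" "pathfinish c3 = b"
    and "path_image c1 \<inter> path_image c2 = {a, b}"
    and "path_image c1 \<inter> path_image c3 = {a, b}"
    and "path_image c2 \<inter> path_image c3 = {a, b}"
    and in3: "path_image c3 - {a, b} \<subseteq> inside (path_image c1 \<union> path_image c2)"
    and c4: "{pathstart c4, pathfinish c4} = {s, t}"
    and in4: "path_image c4 - {s, t} \<subseteq> inside (path_image c1 \<union> path_image c2)"
    and c3c4: "path_image c3 \<inter> path_image c4 = {}"
    and s: "s \<in> path_image c1 - {a, b}" and t: "t \<in> path_image c2 - {a, b}"
  shows False
proof -
  let ?J = "path_image c1 \<union> path_image c2"
  let ?I1 = "inside (path_image c1 \<union> path_image c3)"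
  let ?I2 = "inside (path_image c2 \<union> path_image c3)"
  let ?O = "path_image c4 - {s, t}"
  have "a \<noteq> b" using arc_distinct_ends arcs(1) start finish by blast
  have simple: "simple_path c1" "simple_path c2" "simple_path c3" "simple_path c4"
    using arcs arc_imp_simple_path by blast+
  have ne: "path_image c3 \<inter> inside ?J \<noteq> {}"
    using nonempty_simple_path_endless[OF simple(3)] in3 start finish by auto
  obtain disj: "?I1 \<inter> ?I2 = {}" and split: "?I1 \<union> ?I2 \<union> (path_image c3 - {a, b}) = inside ?J"
    by (rule split_inside_simple_closed_curve[of c1 a b c2 c3])
      (use simple start finish \<open>a \<noteq> b\<close> assms(11-13) ne in auto)
  have "simple_path (c1 +++ reversepath c3)"
    using arcs start finish assms(12) by (intro simple_path_join_loop) (auto simp: arc_reversepath)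
  from Jordan_inside_outside[OF this] have I1: "open ?I1" "frontier ?I1 = path_image c1 \<union> path_image c3"
    using start finish by (auto simp: path_image_join)
  have "simple_path (c2 +++ reversepath c3)"
    using arcs start finish assms(13) by (intro simple_path_join_loop) (auto simp: arc_reversepath)
  from Jordan_inside_outside[OF this] have I2: "open ?I2" "frontier ?I2 = path_image c2 \<union> path_image c3"
    using start finish by (auto simp: path_image_join)
  have endless: "path_image c4 - {pathstart c4, pathfinish c4} = c4 ` {0<..<1}"
    using simple_path_endless simple(4) by blast
  have "connected ?O"
    using connected_simple_path_endless[OF simple(4)] c4 by simp
  moreover have "?O \<subseteq> ?I1 \<union> ?I2"
    using in4 split c3c4 by blast
  ultimately have side: "?O \<subseteq> ?I1 \<or> ?O \<subseteq> ?I2"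
    using connectedD[of ?O ?I1 ?I2] I1 I2 disj by blast
  \<comment> \<open>The ends of \<open>c4\<close> are limits of its open arc, since the closure of
    the open unit interval is the closed one.\<close>
  have "c4 ` closure {0<..<1} \<subseteq> closure ?O"
    using simple(4) endless c4 closure_subset[of ?O]
    by (intro image_closure_subset) (simp_all add: simple_path_def path_def)
  then have "path_image c4 \<subseteq> closure ?O" by (simp add: path_image_def)
  then have st: "s \<in> closure ?O" "t \<in> closure ?O"
    using c4 pathstart_in_path_image[of c4] pathfinish_in_path_image[of c4]
    by (auto simp: doubleton_eq_iff)
  \<comment> \<open>Both points lie on the closed curve, hence in neither open region; it remains to
    exclude the frontier of the wrong region.\<close>
  have "s \<notin> inside ?J" "t \<notin> inside ?J"
    using s t inside_no_overlap[of ?J] by blast+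
  then have off: "s \<notin> ?I2" "t \<notin> ?I1" using split by blast+
  from side show False
  proof
    assume "?O \<subseteq> ?I1"
    then have "t \<in> ?I1 \<union> frontier ?I1" using st closure_mono closure_Un_frontier by blast
    then show False using off I1 t assms(11-13) by blast
  next
    assume "?O \<subseteq> ?I2"
    then have "s \<in> ?I2 \<union> frontier ?I2" using st closure_mono closure_Un_frontier by blast
    then show False using off I2 s assms(11-13) by blast
  qed
qed

section \<open>Point sets of edges and walks in a plane drawing\<close>

lemma plane_drawing_edge:
  assumes "plane_drawing V E p \<gamma>" and "e \<in> E"
  shows "arc (\<gamma> e)" and "{pathstart (\<gamma> e), pathfinish (\<gamma> e)} = p ` e"
    and "path_image (\<gamma> e) \<inter> p ` V = p ` e"
  using assms by (simp_all add: plane_drawing_def)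

lemma plane_drawing_two_edges:
  assumes "plane_drawing V E p \<gamma>" and "e \<in> E" and "f \<in> E" and "e \<noteq> f"
  shows "path_image (\<gamma> e) \<inter> path_image (\<gamma> f) = p ` (e \<inter> f)"
  using assms by (simp add: plane_drawing_def)

text \<open>Edges are unordered sets, so the direction of the drawn arc is unknown; it is reversed
  where necessary.\<close>

lemma edge_arc_from_to:
  assumes "plane_drawing V E p \<gamma>" and "{x, y} \<in> E"
  obtains g where "arc g" "pathstart g = p x" "pathfinish g = p y" "path_image g = path_image (\<gamma> {x, y})"
proof -
  let ?g = "\<gamma> {x, y}"
  have g: "arc ?g" "{pathstart ?g, pathfinish ?g} = {p x, p y}"
    using plane_drawing_edge(1,2)[OF assms] by simp_all
  from g(2) consider "pathstart ?g = p x" "pathfinish ?g = p y"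
    | "pathstart ?g = p y" "pathfinish ?g = p x"
    unfolding doubleton_eq_iff by blast
  then show thesis
  proof cases
    case 1
    then show ?thesis using g(1) that[of ?g] by simp
  next
    case 2
    then show ?thesis using g(1) that[of "reversepath ?g"] by (simp add: arc_reversepath)
  qed
qed

lemma path_image_Int_edge_points:
  assumes "plane_drawing V E p \<gamma>" and "e \<in> E" and "F \<subseteq> E" and "e \<notin> F"
  shows "path_image (\<gamma> e) \<inter> edge_points \<gamma> F = p ` (e \<inter> \<Union>F)"
proof -
  have "path_image (\<gamma> e) \<inter> path_image (\<gamma> f) = p ` (e \<inter> f)" if "f \<in> F" for f
    using assms that by (intro plane_drawing_two_edges[OF assms(1)]) auto
  then have "(\<Union>f\<in>F. path_image (\<gamma> e) \<inter> path_image (\<gamma> f)) = (\<Union>f\<in>F. p ` (e \<inter> f))" by simp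
  also have "\<dots> = p ` (e \<inter> \<Union>F)" by blast
  finally show ?thesis by (simp add: edge_points_def)
qed

lemma edge_points_Int:
  assumes "plane_drawing V E p \<gamma>" and "F1 \<subseteq> E" and "F2 \<subseteq> E" and "F1 \<inter> F2 = {}"
  shows "edge_points \<gamma> F1 \<inter> edge_points \<gamma> F2 = p ` (\<Union>F1 \<inter> \<Union>F2)"
proof -
  have "path_image (\<gamma> e) \<inter> edge_points \<gamma> F2 = p ` (e \<inter> \<Union>F2)" if "e \<in> F1" for e
    using assms that by (intro path_image_Int_edge_points[OF assms(1)]) auto
  then have "(\<Union>e\<in>F1. path_image (\<gamma> e) \<inter> edge_points \<gamma> F2) = (\<Union>e\<in>F1. p ` (e \<inter> \<Union>F2))" by simp
  also have "\<dots> = p ` (\<Union>F1 \<inter> \<Union>F2)" by blast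
  finally show ?thesis by (simp only: edge_points_def[of _ F1] Int_UN_distrib2 UN_simps)
qed

text \<open>Edge arcs are joined one after another. Each new edge is distinct from the later ones,
  so it meets their union only in the images of common vertices, which leaves \<open>p y\<close>
  alone.\<close>

lemma walk_arc:
  assumes drawing: "plane_drawing V E p \<gamma>"
    and "distinct ws" and "2 \<le> length ws" and "walk_edges ws \<subseteq> E"
  shows "\<exists>g. arc g \<and> pathstart g = p (hd ws) \<and> pathfinish g = p (last ws) \<and>
    path_image g = edge_points \<gamma> (walk_edges ws)"
  using assms(2-)
proof (induction ws rule: walk_edges.induct)
  case (1 x y zs)
  obtain g where g: "arc g" "pathstart g = p x" "pathfinish g = p y"
      "path_image g = path_image (\<gamma> {x, y})"
    using edge_arc_from_to[OF drawing, of x y] 1 by auto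
  show ?case
  proof (cases zs)
    case Nil
    then show ?thesis using g by (auto simp: edge_points_def)
  next
    case (Cons z zs')
    obtain h where h: "arc h" "pathstart h = p y" "pathfinish h = p (last (y # zs))"
        "path_image h = edge_points \<gamma> (walk_edges (y # zs))"
      using "1.IH" "1.prems" Cons by auto
    have "{x, y} \<notin> walk_edges (y # zs)"
      using walk_edges_subset[of "{x, y}" "y # zs"] 1 by auto
    then have "path_image g \<inter> path_image h = p ` ({x, y} \<inter> \<Union> (walk_edges (y # zs)))"
      using path_image_Int_edge_points[OF drawing, of "{x, y}" "walk_edges (y # zs)"] 1 g h by auto
    also have "\<dots> \<subseteq> {p y}" using Union_walk_edges[of "y # zs"] Cons 1 by auto
    finally have "arc (g +++ h)" using g h by (intro arc_join) auto
    moreover have "path_image (g +++ h) = edge_points \<gamma> (walk_edges (x # y # zs))"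
      using g h by (auto simp: path_image_join edge_points_def)
    ultimately show ?thesis using g h Cons by (intro exI[of _ "g +++ h"]) auto
  qed
qed auto

text \<open>The outside of the curve is connected and misses the curve, which is the frontier of
  \<open>outside D\<close>. As it meets \<open>outside D\<close>, nonempty by boundedness, it cannot
  leave it.\<close>

lemma outer_face_eq_outside:
  fixes c :: "real \<Rightarrow> complex"
  assumes "simple_path c" and "pathfinish c = pathstart c"
    and "bounded D" and "path_image c \<subseteq> D"
    and "frontier (outside D) = path_image c"
  shows "outside D = outside (path_image c)"
proof
  show sub: "outside D \<subseteq> outside (path_image c)" using assms(4) by (rule outside_mono)
  have "connected (outside (path_image c))" using Jordan_inside_outside assms by blast
  moreover have "outside (path_image c) \<inter> outside D \<noteq> {}"
    using sub outside_bounded_nonempty[OF assms(3)] by blast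
  ultimately show "outside (path_image c) \<subseteq> outside D"
    using connected_Int_frontier[of "outside (path_image c)" "outside D"] assms(5)
      outside_no_overlap[of "path_image c"] by blast
qed

text \<open>The chord \<open>{x, y}\<close> and the two boundary walks between its ends form a theta
  curve, while \<open>b\<close> and \<open>d\<close> lie on different boundary walks. This is the
  configuration excluded by \<open>theta_curve_no_crossing\<close>.\<close>

lemma outerplanar_chords_noncrossing:
  assumes G: "outerplanar_near_triangulation V E p \<gamma> (A @ x # B @ y # D)"
    and xy: "{x, y} \<in> E" and b: "b \<in> set B" and d: "d \<in> set D" and bd: "{b, d} \<in> E"
  shows False
proof -
  let ?c = "A @ x # B @ y # D"
  \<comment> \<open>\<open>?W2\<close> continues past the end of the list, through \<open>D\<close>
    and then \<open>A\<close>, back to \<open>x\<close>.\<close>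
  let ?W1 = "x # B @ [y]" and ?W2 = "y # (D @ A) @ [x]"
  let ?J1 = "edge_points \<gamma> (walk_edges ?W1)" and ?J2 = "edge_points \<gamma> (walk_edges ?W2)"
  let ?D = "drawing_points V E p \<gamma>"
  have simple: "simple_graph V E" and drawing: "plane_drawing V E p \<gamma>" and cyc: "is_cycle V E ?c"
    and fr: "frontier (outside ?D) = edge_points \<gamma> (cycle_edges ?c)"
    using G unfolding outerplanar_near_triangulation_def outer_face_def by blast+
  have dist: "distinct ?c" and cE: "cycle_edges ?c \<subseteq> E" and cV: "set ?c \<subseteq> V"
    using cyc unfolding is_cycle_def by blast+
  have inj: "inj_on p V" using drawing by (simp add: plane_drawing_def)
  note arc_edge = plane_drawing_edge(1)[OF drawing]
  have "cycle_edges ?c = cycle_edges ((x # B @ y # D) @ A)" by (rule cycle_edges_append_commute)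
  also have "\<dots> = walk_edges (x # B @ y # D @ A @ [x])" by (simp add: cycle_edges_eq_walk_edges)
  also have "\<dots> = walk_edges ?W1 \<union> walk_edges ?W2"
    using walk_edges_append[of "x # B" y "D @ A @ [x]"] by simp
  finally have ce: "cycle_edges ?c = walk_edges ?W1 \<union> walk_edges ?W2" .
  have ne: "x \<noteq> y" "b \<notin> {x, y}" "d \<notin> {x, y}" "b \<noteq> d" using dist b d by auto
  have W: "set ?W1 \<inter> set ?W2 = {x, y}" "distinct ?W1" "distinct ?W2" using dist by auto
  have sub: "walk_edges ?W1 \<subseteq> E" "walk_edges ?W2 \<subseteq> E" using ce cE by auto
  have xy1: "{x, y} \<notin> walk_edges ?W1"
    using W b by (intro ends_notin_walk_edges) auto
  have "{y, x} \<notin> walk_edges ?W2"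
    using W d by (intro ends_notin_walk_edges) auto
  then have xy2: "{x, y} \<notin> walk_edges ?W2" by (simp add: insert_commute)
  have card2: "\<And>e. e \<in> E \<Longrightarrow> card e = 2" using simple unfolding simple_graph_def by auto
  \<comment> \<open>The walks share only the vertices \<open>x\<close> and \<open>y\<close>, so a
    shared edge would have to be the chord itself.\<close>
  have edge_disj: "walk_edges ?W1 \<inter> walk_edges ?W2 = {}"
  proof (rule ccontr)
    assume "walk_edges ?W1 \<inter> walk_edges ?W2 \<noteq> {}"
    then obtain e where e: "e \<in> walk_edges ?W1" "e \<in> walk_edges ?W2" by blast
    have "e \<subseteq> {x, y}" using walk_edges_subset[OF e(1)] walk_edges_subset[OF e(2)] W by blast
    moreover have "card e = card {x, y}" using card2 e sub ne by auto
    ultimately have "e = {x, y}" by (intro card_subset_eq) auto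
    then show False using xy1 e by simp
  qed
  have bd_notin: "{b, d} \<notin> walk_edges ?W1 \<union> walk_edges ?W2"
    using walk_edges_subset[of "{b, d}" ?W1] walk_edges_subset[of "{b, d}" ?W2] W b d ne by auto
  have UW: "\<Union> (walk_edges ?W1) = set ?W1" "\<Union> (walk_edges ?W2) = set ?W2"
    by (rule Union_walk_edges; simp)+
  obtain c1 where c1: "arc c1" "pathstart c1 = p x" "pathfinish c1 = p y" "path_image c1 = ?J1"
    using walk_arc[OF drawing W(2) _ sub(1)] by auto
  obtain c2' where c2': "arc c2'" "pathstart c2' = p y" "pathfinish c2' = p x" "path_image c2' = ?J2"
    using walk_arc[OF drawing W(3) _ sub(2)] by auto
  obtain c3 where c3: "arc c3" "pathstart c3 = p x" "pathfinish c3 = p y"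
      "path_image c3 = path_image (\<gamma> {x, y})"
    using edge_arc_from_to[OF drawing xy] .
  obtain c4 where c4: "arc c4" "pathstart c4 = p b" "pathfinish c4 = p d"
      "path_image c4 = path_image (\<gamma> {b, d})"
    using edge_arc_from_to[OF drawing bd] .
  have J12: "?J1 \<inter> ?J2 = {p x, p y}"
    using edge_points_Int[OF drawing sub edge_disj, unfolded UW W(1)] by simp
  let ?j = "c1 +++ c2'"
  have J: "path_image ?j = ?J1 \<union> ?J2" using c1 c2' by (simp add: path_image_join)
  have loop: "simple_path ?j" "pathfinish ?j = pathstart ?j"
    using c1 c2' J12 by (auto intro!: simple_path_join_loop)
  have "finite E" using simple unfolding simple_graph_def
    by (meson PowI finite_Pow_iff finite_subset subsetI)
  then have "bounded (edge_points \<gamma> E)"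
    unfolding edge_points_def using arc_edge by (intro bounded_UN) (auto intro: bounded_arc_image)
  moreover have "bounded (p ` V)"
    using simple by (simp add: simple_graph_def finite_imp_bounded)
  ultimately have "bounded ?D" by (simp add: drawing_points_def)
  moreover have "path_image ?j \<subseteq> ?D"
    using J sub unfolding drawing_points_def edge_points_def by blast
  moreover have "frontier (outside ?D) = path_image ?j"
    unfolding fr J ce edge_points_def by auto
  ultimately have out: "outside ?D = outside (path_image ?j)"
    using outer_face_eq_outside loop by blast
  \<comment> \<open>Away from its ends, such an edge misses the boundary curve. Being part of the
    drawing it also misses the outer face, which \<open>out\<close> identifies with the outside of
    that curve.\<close>
  have chord_inside: "path_image (\<gamma> e) - p ` e \<subseteq> inside (?J1 \<union> ?J2)"
    if e: "e \<in> E" "e \<notin> walk_edges ?W1 \<union> walk_edges ?W2" for e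
  proof
    fix z assume z: "z \<in> path_image (\<gamma> e) - p ` e"
    have "path_image (\<gamma> e) \<inter> ?J1 \<subseteq> p ` e" "path_image (\<gamma> e) \<inter> ?J2 \<subseteq> p ` e"
      using path_image_Int_edge_points[OF drawing e(1) sub(1)]
        path_image_Int_edge_points[OF drawing e(1) sub(2)] e(2) by auto
    then have "z \<notin> ?J1 \<union> ?J2" using z by blast
    moreover have "z \<in> ?D" using z e unfolding drawing_points_def edge_points_def by blast
    then have "z \<notin> outside (?J1 \<union> ?J2)" using out J outside_no_overlap[of ?D] by auto
    ultimately show "z \<in> inside (?J1 \<union> ?J2)" using inside_Un_outside[of "?J1 \<union> ?J2"] by blast
  qed
  have inV: "x \<in> V" "y \<in> V" "b \<in> V" "d \<in> V" using cV b d by auto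
  have off: "p b \<notin> {p x, p y}" "p d \<notin> {p x, p y}" using inj inV ne by (auto dest: inj_onD)
  have onJ: "p z \<in> edge_points \<gamma> F" if "F \<subseteq> E" "z \<in> \<Union>F" for z F
  proof -
    from that(2) obtain e where e: "e \<in> F" "z \<in> e" by blast
    then have "p z \<in> p ` e" "e \<in> E" using that(1) by auto
    then have "p z \<in> path_image (\<gamma> e)" using plane_drawing_edge(3)[OF drawing] by (metis IntD1)
    then show ?thesis using e(1) unfolding edge_points_def by blast
  qed
  \<comment> \<open>The second boundary arc was built from \<open>y\<close> to \<open>x\<close>;
    reversing it makes all three arcs of the theta curve run from \<open>p x\<close> to
    \<open>p y\<close>.\<close>
  show False
  proof (rule theta_curve_no_crossing[of c1 "reversepath c2'" c3 c4 "p x" "p y" "p b" "p d"])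
    show "path_image c1 \<inter> path_image c3 = {p x, p y}"
      using path_image_Int_edge_points[OF drawing xy sub(1) xy1] c1 c3 UW W by auto
    show "path_image (reversepath c2') \<inter> path_image c3 = {p x, p y}"
      using path_image_Int_edge_points[OF drawing xy sub(2) xy2] c2' c3 UW W by auto
    show "path_image c3 - {p x, p y} \<subseteq> inside (path_image c1 \<union> path_image (reversepath c2'))"
      using chord_inside[OF xy] xy1 xy2 c1 c2' c3 by simp
    show "path_image c4 - {p b, p d} \<subseteq> inside (path_image c1 \<union> path_image (reversepath c2'))"
      using chord_inside[OF bd bd_notin] c1 c2' c4 by simp
    have "{x, y} \<noteq> {b, d}" "{x, y} \<inter> {b, d} = {}" using ne by auto
    then show "path_image c3 \<inter> path_image c4 = {}"
      using plane_drawing_two_edges[OF drawing xy bd] c3 c4 by simp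
    show "p b \<in> path_image c1 - {p x, p y}" "p d \<in> path_image (reversepath c2') - {p x, p y}"
      using onJ[OF sub(1), of b, unfolded UW] onJ[OF sub(2), of d, unfolded UW] b d off c1 c2' by simp_all
  qed (use c1 c2' c3 c4 J12 in \<open>auto simp: arc_reversepath\<close>)
qed

section \<open>Extending the colouring\<close>

text \<open>Each vertex is drawn on the frontier of the outer face, hence on some cycle edge, and a
  drawn edge passes through no vertices other than its ends.\<close>

lemma outerplanar_vertices_on_cycle:
  assumes "outerplanar_near_triangulation V E p \<gamma> c"
  shows "V = set c"
proof
  have drawing: "plane_drawing V E p \<gamma>" and cyc: "is_cycle V E c"
    and on: "p ` V \<subseteq> edge_points \<gamma> (cycle_edges c)"
    using assms unfolding outerplanar_near_triangulation_def by blast+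
  show "set c \<subseteq> V" using cyc unfolding is_cycle_def by blast
  have "c \<noteq> []" "cycle_edges c \<subseteq> E" using cyc unfolding is_cycle_def by auto
  show "V \<subseteq> set c"
  proof
    fix x assume x: "x \<in> V"
    then obtain e where e: "e \<in> cycle_edges c" "p x \<in> path_image (\<gamma> e)"
      using on unfolding edge_points_def by blast
    then have "e \<in> E" using \<open>cycle_edges c \<subseteq> E\<close> by blast
    have "e \<subseteq> set c" using walk_edges_subset e \<open>c \<noteq> []\<close>
      by (fastforce simp: cycle_edges_eq_walk_edges)
    moreover have "p x \<in> p ` e"
      using plane_drawing_edge(3)[OF drawing \<open>e \<in> E\<close>] e x by blast
    ultimately have "p x \<in> p ` set c" by blast
    moreover have "inj_on p V" using drawing by (simp add: plane_drawing_def)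
    ultimately show "x \<in> set c"
      using x \<open>set c \<subseteq> V\<close> by (meson inj_on_image_mem_iff)
  qed
qed

text \<open>Cutting the list at positions \<open>i\<close> and \<open>k\<close> puts
  \<open>c ! j\<close> into the middle block and \<open>c ! l\<close> into the final one.\<close>

lemma outerplanar_positions_noncrossing:
  assumes G: "outerplanar_near_triangulation V E p \<gamma> c"
    and ord: "i < j" "j < k" "k < l" "l < length c"
    and "{c ! i, c ! k} \<in> E" and "{c ! j, c ! l} \<in> E"
  shows False
proof -
  define B where "B = take (k - Suc i) (drop (Suc i) c)"
  define D where "D = drop (Suc k) c"
  have "drop (Suc i) c = B @ drop (k - Suc i) (drop (Suc i) c)"
    unfolding B_def by (rule append_take_drop_id[symmetric])
  also have "drop (k - Suc i) (drop (Suc i) c) = c ! k # D"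
    using ord by (simp add: D_def Cons_nth_drop_Suc)
  finally have "c = take i c @ c ! i # B @ c ! k # D"
    using ord by (metis append_take_drop_id Cons_nth_drop_Suc order.strict_trans)
  moreover have "c ! j \<in> set B"
    using ord by (auto simp: B_def in_set_conv_nth intro!: exI[of _ "j - Suc i"])
  moreover have "c ! l \<in> set D"
    using ord by (auto simp: D_def in_set_conv_nth intro!: exI[of _ "l - Suc k"])
  ultimately show False using outerplanar_chords_noncrossing G assms(6-) by metis
qed

text \<open>If every colour of \<open>x\<close> conflicted with \<open>b\<close>, two of them would
  give two distinct edges of a matching sharing \<open>b\<close>.\<close>

lemma correspondence_cover_avoid:
  assumes cover: "correspondence_cover V E L VH EH" and fold: "k_fold 2 V L"
    and xy: "x \<in> V" "y \<in> V" "x \<noteq> y" and b: "b \<in> L y"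
  shows "\<exists>a\<in>L x. {a, b} \<notin> EH"
proof (rule ccontr)
  assume contra: "\<not> ?thesis"
  have "\<not> card (L x) \<le> Suc 0" using fold xy unfolding k_fold_def by fastforce
  \<comment> \<open>An infinite set has cardinality 0 in Isabelle, so the lower bound on
    \<open>card\<close> also forces finiteness.\<close>
  moreover from this have "finite (L x)" using card.infinite by force
  ultimately obtain a a' where a: "a \<in> L x" "a' \<in> L x" "a \<noteq> a'"
    using card_le_Suc0_iff_eq by blast
  have "L x \<inter> L y = {}"
    using cover xy unfolding correspondence_cover_def disjoint_family_on_def by blast
  then have "b \<noteq> a" "b \<noteq> a'" using a b by auto
  have "matching (induced_edges EH (L x \<union> L y))"
    using cover xy unfolding correspondence_cover_def by blast
  moreover have "{a, b} \<in> induced_edges EH (L x \<union> L y)" "{a', b} \<in> induced_edges EH (L x \<union> L y)"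
    using contra a b unfolding induced_edges_def by auto
  moreover have "{a, b} \<noteq> {a', b}" using a \<open>b \<noteq> a\<close> by (auto simp: doubleton_eq_iff)
  ultimately have "disjnt {a, b} {a', b}" unfolding matching_def by (rule pairwiseD)
  then show False by (simp add: disjnt_def)
qed

section \<open>Rotating the outer cycle to a chosen edge\<close>

lemma outerplanar_rotate:
  assumes "outerplanar_near_triangulation V E p \<gamma> (xs @ ys)"
  shows "outerplanar_near_triangulation V E p \<gamma> (ys @ xs)"
proof -
  have "is_cycle V E (xs @ ys) \<longleftrightarrow> is_cycle V E (ys @ xs)"
    unfolding is_cycle_def cycle_edges_append_commute[of xs ys] by auto
  moreover have "is_cycle V E (xs @ ys)"
    using assms unfolding outerplanar_near_triangulation_def by blast
  ultimately show ?thesis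
    using assms
    unfolding outerplanar_near_triangulation_def cycle_edges_append_commute[of xs ys]
    by - (elim conjE, intro conjI; assumption?; simp)
qed

lemma outerplanar_cut_at_edge:
  assumes G: "outerplanar_near_triangulation V E p \<gamma> c" and "{u, v} \<in> cycle_edges c"
  obtains c' where "outerplanar_near_triangulation V E p \<gamma> c'" "{u, v} = {hd c', last c'}"
proof -
  obtain i where i: "i < length c" "{u, v} = {c ! i, c ! (Suc i mod length c)}"
    using assms(2) unfolding cycle_edges_def by blast
  then have "c \<noteq> []" by auto
  \<comment> \<open>The rotated list starts just after position \<open>i\<close>, so the chosen edge
    becomes the closing edge. If \<open>i\<close> is the last position, the list is unchanged and
    its head is \<open>c ! 0\<close>.\<close>
  let ?c = "drop (Suc i) c @ take (Suc i) c"
  have "outerplanar_near_triangulation V E p \<gamma> ?c"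
    using G outerplanar_rotate[of V E p \<gamma> "take (Suc i) c" "drop (Suc i) c"] by simp
  moreover have "last ?c = c ! i" using i by (simp add: take_Suc_conv_app_nth)
  moreover have "hd ?c = c ! (Suc i mod length c)"
    using i \<open>c \<noteq> []\<close>
    by (cases "Suc i = length c") (simp_all add: hd_append hd_drop_conv_nth hd_conv_nth[of c])
  ultimately show thesis using that i by (metis insert_commute)
qed

theorem theorem4p1:
  fixes V :: "'a set" and E :: "'a set set"
    and p :: "'a \<Rightarrow> complex" and \<gamma> :: "'a set \<Rightarrow> real \<Rightarrow> complex" and c :: "'a list"
    and L :: "'a \<Rightarrow> 'b set" and VH :: "'b set" and EH :: "'b set set"
    and \<phi> :: "'a \<Rightarrow> 'b option" and u v :: 'a
  assumes "outerplanar_near_triangulation V E p \<gamma> c"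
    and "u \<in> set c" and "v \<in> set c" and "{u, v} \<in> cycle_edges c"
    and "correspondence_cover V E L VH EH" and "k_fold 2 V L"
    and "partial_coloring V L \<phi>" and "dom \<phi> = {u, v}" and "defective 3 E EH \<phi>"
  shows "\<exists>\<psi>. coloring V L \<psi> \<and> \<phi> \<subseteq>\<^sub>m \<psi> \<and> defective 3 E EH \<psi> \<and>
    ({the (\<phi> u), the (\<phi> v)} \<in> EH \<longrightarrow> defect E EH \<psi> u \<le> 1 \<and> defect E EH \<psi> v \<le> 2) \<and>
    ({the (\<phi> u), the (\<phi> v)} \<notin> EH \<longrightarrow> defect E EH \<psi> u = 0 \<and> defect E EH \<psi> v \<le> 1)"
proof -
  \<comment> \<open>From here on \<open>c\<close> is the outer cycle cut at the edge
    \<open>uv\<close>. Either of \<open>u\<close> and \<open>v\<close> may come first, so the two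
    ends are compared as unordered pairs.\<close>
  obtain c where G: "outerplanar_near_triangulation V E p \<gamma> c" and uv: "{u, v} = {hd c, last c}"
    using outerplanar_cut_at_edge[OF assms(1,4)] .
  have V: "V = set c" using outerplanar_vertices_on_cycle[OF G] .
  have simple: "simple_graph V E" and cyc: "is_cycle V E c"
    using G unfolding outerplanar_near_triangulation_def by blast+
  have dist: "distinct c" and len: "3 \<le> length c" using cyc unfolding is_cycle_def by auto
  define m where "m = length c - 1"
  have m: "0 < m" "length c = Suc m" using len by (auto simp: m_def)
  have bij: "bij_betw ((!) c) {0..m} V"
    using bij_betw_nth[OF dist] m V by (simp add: atLeast0AtMost lessThan_Suc_atMost)
  define pos where "pos = inv_into {0..m} ((!) c)"
  have pos: "pos x \<in> {0..m}" "c ! pos x = x" if "x \<in> V" for x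
    using bij that unfolding pos_def
    by (metis bij_betw_imp_surj_on inv_into_into, metis bij_betw_inv_into_right)
  have pos_nth: "pos (c ! i) = i" if "i \<in> {0..m}" for i
    using bij that unfolding pos_def by (simp add: bij_betw_inv_into_left)
  have nthV: "c ! i \<in> V" if "i \<in> {0..m}" for i using bij that by (auto simp: bij_betw_def)
  have ne_edge: "x \<noteq> y" if "{x, y} \<in> E" for x y
    using simple that unfolding simple_graph_def by fastforce
  have c0: "{u, v} = {c ! 0, c ! m}"
    using uv m by (metis hd_conv_nth last_conv_nth length_0_conv m_def nat.distinct(1))
  have uvV: "u \<in> V" "v \<in> V" using c0 nthV m by (auto simp: doubleton_eq_iff)
  have uv_pos: "{pos u, pos v} = {0, m}"
    using c0 pos_nth m by (auto simp: doubleton_eq_iff)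
  have uv_ne: "u \<noteq> v" using uv_pos m by auto
  define K where "K x a y b \<longleftrightarrow> {c ! x, c ! y} \<in> E \<and> {a, b} \<in> EH" for x a y b
  have \<phi>L: "the (\<phi> x) \<in> L x" if "x \<in> {u, v}" for x
    using assms(7,8) that unfolding partial_coloring_def by auto
  \<comment> \<open>The protected end is the position of \<open>u\<close>, because \<open>u\<close>
    must gain no conflict while \<open>v\<close> may gain one.\<close>
  have "\<exists>\<psi>. \<psi> 0 = the (\<phi> (c ! 0)) \<and> \<psi> m = the (\<phi> (c ! m)) \<and> (\<forall>x\<in>{0..m}. \<psi> x \<in> L (c ! x)) \<and>
    (\<forall>x\<in>{0<..<m}. card {y\<in>{0..m}. K x (\<psi> x) y (\<psi> y)} \<le> 3) \<and>
    (\<forall>x\<in>{0, m}. card {y\<in>{0<..<m}. K x (\<psi> x) y (\<psi> y)} \<le> (if x = pos u then 0 else 1))"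
  proof (rule defective_extension_on_interval[where E = "\<lambda>x y. {c ! x, c ! y} \<in> E"])
    show "0 < m" by (rule m)
    show "pos u \<in> {0, m}" using uv_pos by blast
    show "{c ! b, c ! d} \<notin> E" if "a < b" "b < k" "k < d" "d \<le> m" "{c ! a, c ! k} \<in> E" for a b k d
      using outerplanar_positions_noncrossing[OF G that(1-3)] that m by auto
    show "x \<noteq> y \<and> {c ! x, c ! y} \<in> E" if "K x a y b" for x a y b
      using that ne_edge unfolding K_def by blast
    show "K y b x a" if "K x a y b" for x a y b
      using that unfolding K_def by (simp add: insert_commute)
    show "\<exists>a\<in>L (c ! x). \<not> K x a y b" if "x \<le> m" "y \<le> m" "x \<noteq> y" "b \<in> L (c ! y)" for x y b
    proof -
      have "c ! x \<noteq> c ! y" using that pos_nth by (metis atLeastAtMost_iff zero_le)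
      then show ?thesis
        using correspondence_cover_avoid[OF assms(5,6), of "c ! x" "c ! y" b] that nthV
        unfolding K_def by auto
    qed
    show "the (\<phi> (c ! 0)) \<in> L (c ! 0)" "the (\<phi> (c ! m)) \<in> L (c ! m)"
      using \<phi>L c0 by auto
  qed
  then obtain \<psi> where \<psi>: "\<psi> 0 = the (\<phi> (c ! 0))" "\<psi> m = the (\<phi> (c ! m))"
    "\<And>x. x \<in> {0..m} \<Longrightarrow> \<psi> x \<in> L (c ! x)"
    "\<And>x. x \<in> {0<..<m} \<Longrightarrow> card {y\<in>{0..m}. K x (\<psi> x) y (\<psi> y)} \<le> 3"
    "\<And>x. x \<in> {0, m} \<Longrightarrow> card {y\<in>{0<..<m}. K x (\<psi> x) y (\<psi> y)} \<le> (if x = pos u then 0 else 1)"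
    by blast
  define \<psi>' where "\<psi>' x = (if x \<in> V then Some (\<psi> (pos x)) else None)" for x
  have dom: "dom \<psi>' = V" by (auto simp: \<psi>'_def split: if_splits)
  have coloring: "coloring V L \<psi>'"
  proof -
    have "the (\<psi>' x) \<in> L x" if "x \<in> V" for x
      using \<psi>(3)[OF pos(1)[OF that]] pos(2)[OF that] that by (simp add: \<psi>'_def)
    then show ?thesis unfolding coloring_def partial_coloring_def dom by blast
  qed
  have \<psi>_uv: "\<psi> (pos x) = the (\<phi> x)" if "x \<in> {u, v}" for x
  proof -
    have "pos x \<in> {pos u, pos v}" using that by blast
    then have "pos x \<in> {0, m}" unfolding uv_pos .
    moreover have "c ! pos x = x" using that pos(2) uvV by blast
    ultimately show ?thesis using \<psi>(1,2) by (metis insertE singletonD)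
  qed
  have ext: "\<phi> \<subseteq>\<^sub>m \<psi>'"
    unfolding map_le_def
  proof
    fix x assume "x \<in> dom \<phi>"
    then obtain a where "\<phi> x = Some a" by blast
    moreover have "x \<in> {u, v}" using \<open>x \<in> dom \<phi>\<close> unfolding assms(8) .
    moreover from this have "x \<in> V" using uvV by blast
    ultimately show "\<phi> x = \<psi>' x" using \<psi>_uv by (simp add: \<psi>'_def)
  qed
  \<comment> \<open>Enumerating the vertices along \<open>c\<close> is a bijection that carries
    conflicting positions to conflicting neighbours.\<close>
  have defect: "defect E EH \<psi>' x = card {y\<in>{0..m}. K (pos x) (\<psi> (pos x)) y (\<psi> y)}"
    if x: "x \<in> V" for x
  proof -
    have "{y \<in> V. {x, y} \<in> E \<and> {the (\<psi>' x), the (\<psi>' y)} \<in> EH} =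
      (!) c ` {y\<in>{0..m}. K (pos x) (\<psi> (pos x)) y (\<psi> y)}"
    proof (intro equalityI subsetI)
      fix y assume "y \<in> {y \<in> V. {x, y} \<in> E \<and> {the (\<psi>' x), the (\<psi>' y)} \<in> EH}"
      then show "y \<in> (!) c ` {y\<in>{0..m}. K (pos x) (\<psi> (pos x)) y (\<psi> y)}"
        using pos x by (intro image_eqI[of _ _ "pos y"]) (auto simp: K_def \<psi>'_def)
    qed (use pos x nthV pos_nth in \<open>auto simp: K_def \<psi>'_def\<close>)
    moreover have "inj_on ((!) c) {y\<in>{0..m}. K (pos x) (\<psi> (pos x)) y (\<psi> y)}"
      using bij by (auto simp: bij_betw_def intro: inj_on_subset)
    ultimately show ?thesis unfolding defect_def dom by (simp add: card_image)
  qed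
  \<comment> \<open>One estimate serves both claims about \<open>u\<close> and \<open>v\<close>: the
    first summand bounds conflicts with the other vertices, the second accounts for the prescribed
    conflict between \<open>u\<close> and \<open>v\<close>.\<close>
  have bound: "defect E EH \<psi>' x \<le> (if x = u then 0 else 1) + (if {the (\<phi> u), the (\<phi> v)} \<in> EH then 1 else 0)"
    if x: "x \<in> {u, v}" for x
  proof -
    let ?N = "{y\<in>{0<..<m}. K (pos x) (\<psi> (pos x)) y (\<psi> y)}"
    define w where "w = (if x = u then v else u)"
    let ?W = "if {the (\<phi> u), the (\<phi> v)} \<in> EH then {pos w} else {}"
    have xw: "x \<in> V" "w \<in> {u, v}" "{pos x, pos w} = {0, m}" "{x, w} = {u, v}"
      using x uvV uv_pos uv_pos[unfolded insert_commute[of "pos u"]]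
      by (cases "x = u"; simp add: w_def insert_commute)+
    have "{y\<in>{0..m}. K (pos x) (\<psi> (pos x)) y (\<psi> y)} \<subseteq> ?N \<union> ?W"
    proof
      fix y assume y: "y \<in> {y\<in>{0..m}. K (pos x) (\<psi> (pos x)) y (\<psi> y)}"
      have "y \<noteq> pos x" using y ne_edge unfolding K_def by blast
      then consider "y \<in> {0<..<m}" | "y = pos w"
        using y xw(3) by (cases "y = 0"; cases "y = m") (auto simp: doubleton_eq_iff)
      then show "y \<in> ?N \<union> ?W"
      proof cases
        case 2
        then have "{the (\<phi> x), the (\<phi> w)} \<in> EH" using y \<psi>_uv x xw(2) unfolding K_def by auto
        moreover have "{the (\<phi> x), the (\<phi> w)} = {the (\<phi> u), the (\<phi> v)}"
          using x by (auto simp: w_def)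
        ultimately show ?thesis using 2 by simp
      qed (use y in auto)
    qed
    then have "defect E EH \<psi>' x \<le> card (?N \<union> ?W)"
      unfolding defect[OF xw(1)] by (intro card_mono) auto
    also have "\<dots> \<le> card ?N + card ?W" by (rule card_Un_le)
    also have "card ?N \<le> (if x = u then 0 else 1)"
    proof -
      have "pos x = pos u \<longleftrightarrow> x = u" using pos(2) uvV xw(1) by metis
      moreover have "pos x \<in> {0, m}" using xw(3) by blast
      ultimately show ?thesis using \<psi>(5)[of "pos x"] by simp
    qed
    finally show ?thesis by auto
  qed
  \<comment> \<open>At \<open>u\<close> and \<open>v\<close> the preceding bound is at most 2; every
    other vertex is an inner position of the interval.\<close>
  have "defect E EH \<psi>' x \<le> 3" if x: "x \<in> V" for x
  proof (cases "x \<in> {u, v}")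
    case True
    then show ?thesis using bound[of x] by (auto split: if_splits)
  next
    case False
    then have "pos x \<notin> {pos u, pos v}" using pos(2) x uvV by (metis insert_iff singletonD)
    then have "pos x \<notin> {0, m}" unfolding uv_pos .
    then have "pos x \<in> {0<..<m}" using pos(1)[OF x] by auto
    then show ?thesis using \<psi>(4) defect[OF x] by simp
  qed
  then have "defective 3 E EH \<psi>'" unfolding defective_def dom by blast
  then show ?thesis
    using coloring ext bound[of u] bound[of v] uv_ne by (intro exI[of _ \<psi>']) auto
qed

end
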